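(* Let $\mathrm{a}_{n,k}^{\mathrm{pk}}(132,321)$ denote the number of permutations of $\{1,\dots,n\}$ that avoid both $132$ and $321$ and have exactly $k$ peaks. Then for all integers $n\ge1$ and $k\ge0$, $$\mathrm{a}_{n,k}^{\mathrm{pk}}(132,321)=\begin{cases}n,&k=0;\\ \binom{n-1}{2},&k=1;\\ 0,&\text{otherwise}.\end{cases}$$
   Context: $\mathcal{S}_n$ is the set of permutations $\pi=\pi_1\cdots\pi_n$ of $\{1,\dots,n\}$. For $\rho\in\mathcal{S}_m$, $\pi\in\mathcal{S}_n$ contains $\rho$ if there are indices $1\le i_1<\cdots<i_m\le n$ such that $\pi_{i_a}<\pi_{i_b}$ if and only if $\rho_a<\rho_b$; otherwise $\pi$ avoids $\rho$. The number of peaks is $\mathrm{pk}(\pi)=|\{i:\pi_i<\pi_{i+1}\text{ and }\pi_{i+1}>\pi_{i+2}\}|$, where $1\le i\le n-2$. Binomial coefficients $\binom{m}{j}$ with $j>m\ge 0$ are $0$. *)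

theory Defs
  imports Main "HOL-Combinatorics.Multiset_Permutations"
begin

text \<open>
  Permutations of \<open>{1..n}\<close> are lists in one-line notation, i.e. elements of
  \<open>permutations_of_set {1..n}\<close>. List positions start at \<open>0\<close>, so the entry
  \<open>\<pi>\<^sub>i\<close> is \<open>\<pi> ! (i - 1)\<close>.
\<close>

definition contains :: "nat list \<Rightarrow> nat list \<Rightarrow> bool" where
  "contains \<pi> \<rho> \<longleftrightarrow>
     (\<exists>f. strict_mono_on {..<length \<rho>} f \<and> f ` {..<length \<rho>} \<subseteq> {..<length \<pi>} \<and>
       (\<forall>a<length \<rho>. \<forall>b<length \<rho>. \<pi> ! f a < \<pi> ! f b \<longleftrightarrow> \<rho> ! a < \<rho> ! b))"

abbreviation avoids :: "nat list \<Rightarrow> nat list \<Rightarrow> bool" where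
  "avoids \<pi> \<rho> \<equiv> \<not> contains \<pi> \<rho>"

definition pk :: "nat list \<Rightarrow> nat" where
  "pk \<pi> = card {i. i + 2 < length \<pi> \<and> \<pi> ! i < \<pi> ! (i + 1) \<and> \<pi> ! (i + 1) > \<pi> ! (i + 2)}"

definition a_pk :: "nat \<Rightarrow> nat \<Rightarrow> nat list set \<Rightarrow> nat" where
  "a_pk n k P = card {\<pi> \<in> permutations_of_set {1..n}. (\<forall>\<rho>\<in>P. avoids \<pi> \<rho>) \<and> pk \<pi> = k}"

end

theory Submission
  imports Defs "HOL-Library.Sublist"
begin

text \<open>
  Write a permutation of \<open>{1..n + 1}\<close> as \<open>L @ (n + 1) # R\<close>. If it avoids \<open>132\<close> and \<open>321\<close> and
  \<open>R\<close> is nonempty, then every entry of \<open>L\<close> exceeds every entry of \<open>R\<close>, \<open>R\<close> is increasing, and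
  \<open>L\<close> is increasing as well, because a descent in \<open>L\<close> followed by an entry of \<open>R\<close> is a \<open>321\<close>.
  So the permutation is one of the \<open>n\<close> nontrivial rotations of the identity; these have one peak,
  except for \<open>(n + 1) 1 2 \<dots> n\<close>, which has none. If \<open>R\<close> is empty, then deleting the maximum at the
  end leaves a permutation of \<open>{1..n}\<close> with the same property and the same number of peaks.
  The counts follow by induction, with Pascal's rule for \<open>k = 1\<close>.
\<close>

section \<open>Pattern containment through subsequences\<close>

text \<open>Bridge from the index embeddings in \<open>contains\<close> to the library relation
  \<open>subseq\<close>, whose rules for append and cons spare index arithmetic later.\<close>

lemma subseq_iff_strict_mono_on:
  "subseq xs ys \<longleftrightarrow>
     (\<exists>f. strict_mono_on {..<length xs} f \<and> f ` {..<length xs} \<subseteq> {..<length ys} \<and>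
       xs = map (\<lambda>a. ys ! f a) [0..<length xs])" (is "_ \<longleftrightarrow> (\<exists>f. ?E xs ys f)")
proof
  assume "subseq xs ys"
  then show "\<exists>f. ?E xs ys f"
  proof (induction rule: list_emb.induct)
    case (list_emb_Nil ys)
    then show ?case by (simp add: strict_mono_on_def)
  next
    case (list_emb_Cons xs ys y)
    then obtain f where "?E xs ys f" by blast
    then have "?E xs (y # ys) (\<lambda>a. Suc (f a))"
      by (auto simp: strict_mono_on_def)
    then show ?case by blast
  next
    case (list_emb_Cons2 x y xs ys)
    then obtain f where f: "?E xs ys f" by blast
    \<comment> \<open>Both lists gain a head: index 0 goes to 0 and all other indices shift by
      one.\<close>
    define g where "g = (\<lambda>a. case a of 0 \<Rightarrow> 0 | Suc b \<Rightarrow> Suc (f b))"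
    have "strict_mono_on {..<length (x # xs)} g"
      using f by (auto simp: g_def strict_mono_on_def split: nat.split)
    moreover have "g ` {..<length (x # xs)} \<subseteq> {..<length (y # ys)}"
    proof -
      have "f a < length ys" if "a < length xs" for a
        using f that by blast
      then show ?thesis by (auto simp: g_def split: nat.split)
    qed
    moreover have "x # xs = map (\<lambda>a. (y # ys) ! g a) [0..<length (x # xs)]"
    proof (rule nth_equalityI)
      fix i assume "i < length (x # xs)"
      moreover have "xs ! j = ys ! f j" if "j < length xs" for j
      proof -
        have "xs ! j = map (\<lambda>a. ys ! f a) [0..<length xs] ! j"
          using f by metis
        then show ?thesis using that by simp
      qed
      ultimately show "(x # xs) ! i = map (\<lambda>a. (y # ys) ! g a) [0..<length (x # xs)] ! i"
        using list_emb_Cons2.hyps by (cases i) (auto simp: g_def simp del: upt_Suc)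
    qed simp
    ultimately show ?case by (intro exI[of _ g] conjI)
  qed
next
  assume "\<exists>f. ?E xs ys f"
  then obtain f where f: "?E xs ys f" by blast
  define js where "js = map f [0..<length xs]"
  have "sorted_wrt (<) js"
    using f by (auto simp: js_def sorted_wrt_iff_nth_less strict_mono_on_def)
  moreover have "set js \<subseteq> {..<length ys}"
    using f by (simp add: js_def atLeast0LessThan)
  \<comment> \<open>A strictly increasing list is determined by its set, so the chosen positions are
    a filter of all positions; mapping \<open>(!) ys\<close> over both lists then gives the
    claim.\<close>
  ultimately have "js = filter (\<lambda>i. i \<in> set js) [0..<length ys]"
    by (intro sorted_distinct_set_unique) (auto simp: strict_sorted_iff sorted_wrt_filter)
  then have "subseq js [0..<length ys]"
    by (metis subseq_filter_left)
  then have "subseq (map ((!) ys) js) (map ((!) ys) [0..<length ys])"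
    by (rule subseq_map)
  moreover have "map ((!) ys) js = xs"
    using f by (simp add: js_def comp_def)
  ultimately show "subseq xs ys"
    by (simp add: map_nth)
qed

lemma contains_iff_subseq:
  "contains \<pi> \<rho> \<longleftrightarrow>
     (\<exists>\<sigma>. subseq \<sigma> \<pi> \<and> length \<sigma> = length \<rho> \<and>
       (\<forall>a<length \<rho>. \<forall>b<length \<rho>. \<sigma> ! a < \<sigma> ! b \<longleftrightarrow> \<rho> ! a < \<rho> ! b))" (is "_ \<longleftrightarrow> ?R")
proof
  assume "contains \<pi> \<rho>"
  then obtain f where f: "strict_mono_on {..<length \<rho>} f" "f ` {..<length \<rho>} \<subseteq> {..<length \<pi>}"
    "\<forall>a<length \<rho>. \<forall>b<length \<rho>. \<pi> ! f a < \<pi> ! f b \<longleftrightarrow> \<rho> ! a < \<rho> ! b"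
    unfolding contains_def by blast
  have "subseq (map (\<lambda>a. \<pi> ! f a) [0..<length \<rho>]) \<pi>"
    unfolding subseq_iff_strict_mono_on using f by (intro exI[of _ f]) simp
  with f(3) show ?R
    by (intro exI[of _ "map (\<lambda>a. \<pi> ! f a) [0..<length \<rho>]"]) simp
next
  assume ?R
  then obtain \<sigma> f where \<sigma>: "length \<sigma> = length \<rho>"
      "\<forall>a<length \<rho>. \<forall>b<length \<rho>. \<sigma> ! a < \<sigma> ! b \<longleftrightarrow> \<rho> ! a < \<rho> ! b"
    and f: "strict_mono_on {..<length \<sigma>} f" "f ` {..<length \<sigma>} \<subseteq> {..<length \<pi>}"
      "\<sigma> = map (\<lambda>a. \<pi> ! f a) [0..<length \<sigma>]"
    unfolding subseq_iff_strict_mono_on by blast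
  have "\<sigma> ! a = \<pi> ! f a" if "a < length \<sigma>" for a
  proof -
    have "\<sigma> ! a = map (\<lambda>a. \<pi> ! f a) [0..<length \<sigma>] ! a"
      using f(3) by metis
    then show ?thesis using that by simp
  qed
  then show "contains \<pi> \<rho>"
    unfolding contains_def using \<sigma> f by (intro exI[of _ f]) auto
qed

lemma all_less_3_iff: "(\<forall>a<3. P a) \<longleftrightarrow> P 0 \<and> P 1 \<and> P (2::nat)"
  by (auto simp: numeral_3_eq_3 numeral_2_eq_2 less_Suc_eq)

text \<open>Of the nine comparisons in the order isomorphism, the chain a < c < b implies all
  others.\<close>

lemma contains_132_iff: "contains \<pi> [1, 3, 2] \<longleftrightarrow> (\<exists>a b c. subseq [a, b, c] \<pi> \<and> a < c \<and> c < b)"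
proof -
  have "(\<forall>a<3. \<forall>b<3. \<sigma> ! a < \<sigma> ! b \<longleftrightarrow> [1, 3, 2::nat] ! a < [1, 3, 2] ! b) \<longleftrightarrow>
      \<sigma> ! 0 < \<sigma> ! 2 \<and> \<sigma> ! 2 < \<sigma> ! 1" for \<sigma> :: "nat list"
    unfolding all_less_3_iff by simp linarith
  moreover have len: "length [1, 3, 2::nat] = 3"
    by simp
  ultimately have "contains \<pi> [1, 3, 2] \<longleftrightarrow>
      (\<exists>\<sigma>. subseq \<sigma> \<pi> \<and> length \<sigma> = 3 \<and> \<sigma> ! 0 < \<sigma> ! 2 \<and> \<sigma> ! 2 < \<sigma> ! 1)"
    unfolding contains_iff_subseq len by simp
  also have "\<dots> \<longleftrightarrow> (\<exists>a b c. subseq [a, b, c] \<pi> \<and> a < c \<and> c < b)"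
    by (force simp: length_Suc_conv numeral_3_eq_3)
  finally show ?thesis .
qed

lemma contains_321_iff: "contains \<pi> [3, 2, 1] \<longleftrightarrow> (\<exists>a b c. subseq [a, b, c] \<pi> \<and> c < b \<and> b < a)"
proof -
  have "(\<forall>a<3. \<forall>b<3. \<sigma> ! a < \<sigma> ! b \<longleftrightarrow> [3, 2::nat, 1] ! a < [3, 2, 1] ! b) \<longleftrightarrow>
      \<sigma> ! 2 < \<sigma> ! 1 \<and> \<sigma> ! 1 < \<sigma> ! 0" for \<sigma> :: "nat list"
    unfolding all_less_3_iff by simp linarith
  moreover have len: "length [3, 2::nat, 1] = 3"
    by simp
  ultimately have "contains \<pi> [3, 2, 1] \<longleftrightarrow>
      (\<exists>\<sigma>. subseq \<sigma> \<pi> \<and> length \<sigma> = 3 \<and> \<sigma> ! 2 < \<sigma> ! 1 \<and> \<sigma> ! 1 < \<sigma> ! 0)"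
    unfolding contains_iff_subseq len by simp
  also have "\<dots> \<longleftrightarrow> (\<exists>a b c. subseq [a, b, c] \<pi> \<and> c < b \<and> b < a)"
    by (force simp: length_Suc_conv numeral_3_eq_3)
  finally show ?thesis .
qed

lemma contains_subseq: "contains \<sigma> \<rho> \<Longrightarrow> subseq \<sigma> \<pi> \<Longrightarrow> contains \<pi> \<rho>"
  unfolding contains_iff_subseq by (meson subseq_order.trans)

lemma not_subseq_desc_if_sorted:
  assumes "sorted xs" "b < (a::'a::linorder)"
  shows "\<not> subseq [a, b] xs"
proof
  assume "subseq [a, b] xs"
  then have "sorted [a, b]"
    using assms(1) unfolding subseq_conv_nths by (metis sorted_nths)
  with assms(2) show False by simp
qed

lemma subseq_imp_set_subset: "subseq xs ys \<Longrightarrow> set xs \<subseteq> set ys"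
  by (blast elim: list_emb_set)

text \<open>The disjuncts are the four ways to cut a triple in two; a part with a single entry
  reduces to membership.\<close>

lemma subseq_triple_append_iff:
  "subseq [a, b, c] (xs @ ys) \<longleftrightarrow>
     subseq [a, b, c] xs \<or> subseq [a, b] xs \<and> c \<in> set ys \<or>
     a \<in> set xs \<and> subseq [b, c] ys \<or> subseq [a, b, c] ys"
proof -
  have "[a, b, c] = us @ vs \<longleftrightarrow> us = [a, b, c] \<and> vs = [] \<or> us = [a, b] \<and> vs = [c] \<or>
      us = [a] \<and> vs = [b, c] \<or> us = [] \<and> vs = [a, b, c]" for us vs
    by (auto simp: Cons_eq_append_conv)
  then have "subseq [a, b, c] (xs @ ys) \<longleftrightarrow> subseq [a, b, c] xs \<or> subseq [a, b] xs \<and> subseq [c] ys \<or>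
      subseq [a] xs \<and> subseq [b, c] ys \<or> subseq [a, b, c] ys"
    by (simp add: subseq_append_iff conj_disj_distribR ex_disj_distrib)
  then show ?thesis
    by (simp add: subseq_singleton_left)
qed

text \<open>Supplies the inversion that a further entry extends to a 321. Either the head exceeds an
  entry of a sorted tail, or the tail already has an inversion.\<close>

lemma subseq_pair_if_not_sorted:
  assumes "\<not> sorted (xs :: 'a::linorder list)"
  obtains a b where "subseq [a, b] xs" "b < a"
proof -
  have "\<exists>a b. subseq [a, b] xs \<and> b < a"
    using assms
  proof (induction xs)
    case (Cons x xs)
    show ?case
    proof (cases "sorted xs")
      case True
      with Cons.prems obtain y where "y \<in> set xs" "y < x" by auto
      then show ?thesis
        by (intro exI[of _ x] exI[of _ y]) (simp add: subseq_singleton_left)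
    next
      case False
      with Cons.IH show ?thesis by (meson list_emb_Cons)
    qed
  qed simp
  with that show thesis by blast
qed

section \<open>Structure of the avoidance class\<close>

definition Av_132_321 :: "nat \<Rightarrow> nat list set" where
  "Av_132_321 n = {\<pi> \<in> permutations_of_set {1..n}. \<forall>\<rho>\<in>{[1, 3, 2], [3, 2, 1]}. avoids \<pi> \<rho>}"

text \<open>The identity rotated left by \<open>r\<close> places, for \<open>r\<close> at most
  \<open>n\<close>; both \<open>r = 0\<close> and \<open>r = n\<close> give the identity
  itself.\<close>

definition rot_id :: "nat \<Rightarrow> nat \<Rightarrow> nat list" where
  "rot_id n r = [Suc r..<Suc n] @ [1..<Suc r]"

lemma a_pk_eq_card_Av:
  "a_pk n k {[1, 3, 2], [3, 2, 1]} = card {\<pi> \<in> Av_132_321 n. pk \<pi> = k}"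
  unfolding a_pk_def Av_132_321_def by (rule arg_cong[where f = card]) auto

lemma finite_Av: "finite (Av_132_321 n)"
  by (simp add: Av_132_321_def)

text \<open>Both patterns end with a descent, so a final maximum cannot take part in an occurrence
  of either.\<close>

lemma snoc_max_in_Av:
  assumes "\<sigma> \<in> Av_132_321 n"
  shows "\<sigma> @ [Suc n] \<in> Av_132_321 (Suc n)"
proof -
  have \<sigma>: "set \<sigma> = {1..n}" "distinct \<sigma>"
    "avoids \<sigma> [1, 3, 2]" "avoids \<sigma> [3, 2, 1]"
    using assms by (auto simp: Av_132_321_def permutations_of_set_def)
  have *: "subseq [a, b, c] \<sigma>"
    if abc: "subseq [a, b, c] (\<sigma> @ [Suc n])" and "c < b" for a b c
  proof -
    consider "subseq [a, b, c] \<sigma>" | "c = Suc n" "subseq [a, b] \<sigma>"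
      using abc by (auto simp: subseq_triple_append_iff split: if_splits dest: list_emb_Nil2)
    then show ?thesis
      by cases (use \<sigma>(1) \<open>c < b\<close> in \<open>auto dest: subseq_imp_set_subset\<close>)
  qed
  have "avoids (\<sigma> @ [Suc n]) [1, 3, 2]" "avoids (\<sigma> @ [Suc n]) [3, 2, 1]"
    using \<sigma>(3,4) unfolding contains_132_iff contains_321_iff
    by (blast dest: *)+
  then show ?thesis
    using \<sigma>(1,2) by (auto simp: Av_132_321_def permutations_of_set_def)
qed

text \<open>Both blocks increase, so the descent from b to c ending either pattern must cross from
  the first block to the second. Then a lies before b in the first block, whence c < a < b, which
  fits neither pattern.\<close>

lemma rot_id_in_Av:
  assumes "r \<le> n"
  shows "rot_id n r \<in> Av_132_321 n"
proof -
  let ?A = "[Suc r..<Suc n]" and ?B = "[1..<Suc r]"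
  have nA: "\<not> subseq [a, b] ?A" and nB: "\<not> subseq [a, b] ?B" if "b < a" for a b
    by (rule not_subseq_desc_if_sorted[OF _ that]; simp del: upt_Suc)+
  \<comment> \<open>Given c < b, the alternative a < c yields 132 and b < a yields 321, so both
    patterns are treated at once.\<close>
  have *: False if abc: "subseq [a, b, c] (?A @ ?B)" and less: "c < b" "a < c \<or> b < a" for a b c
  proof -
    consider "subseq [a, b, c] ?A" | "subseq [a, b] ?A" "c \<in> set ?B"
      | "a \<in> set ?A" "subseq [b, c] ?B" | "subseq [a, b, c] ?B"
      using abc unfolding subseq_triple_append_iff by blast
    then show False
    proof cases
      case 1
      then have "subseq [b, c] ?A" by (rule subseq_Cons')
      with nA less(1) show False by blast
    next
      case 2
      then have "a \<in> set ?A" by (auto dest: subseq_imp_set_subset)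
      with 2 nA less show False by auto
    next
      case 3
      with nB less(1) show False by blast
    next
      case 4
      then have "subseq [b, c] ?B" by (rule subseq_Cons')
      with nB less(1) show False by blast
    qed
  qed
  have "avoids (rot_id n r) [1, 3, 2]" "avoids (rot_id n r) [3, 2, 1]"
    unfolding contains_132_iff contains_321_iff rot_id_def by (blast dest: *)+
  moreover have "set (rot_id n r) = {1..n}" "distinct (rot_id n r)"
    using assms by (auto simp: rot_id_def)
  ultimately show ?thesis
    by (simp add: Av_132_321_def permutations_of_set_def)
qed

lemma Av_SucE:
  assumes "\<pi> \<in> Av_132_321 (Suc n)"
  obtains (snoc) \<sigma> where "\<sigma> \<in> Av_132_321 n" "\<pi> = \<sigma> @ [Suc n]"
    | (rot) r where "r \<in> {1..n}" "\<pi> = rot_id (Suc n) r"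
proof -
  have \<pi>: "set \<pi> = {1..Suc n}" "distinct \<pi>"
    and no132: "\<And>a b c. subseq [a, b, c] \<pi> \<Longrightarrow> a < c \<Longrightarrow> c < b \<Longrightarrow> False"
    and no321: "\<And>a b c. subseq [a, b, c] \<pi> \<Longrightarrow> c < b \<Longrightarrow> b < a \<Longrightarrow> False"
    and av: "avoids \<pi> [1, 3, 2]" "avoids \<pi> [3, 2, 1]"
    using assms unfolding Av_132_321_def permutations_of_set_def mem_Collect_eq ball_simps
      contains_132_iff contains_321_iff by blast+
  from \<pi>(1) have "Suc n \<in> set \<pi>" by simp
  then obtain L R where LR: "\<pi> = L @ Suc n # R" by (meson split_list)
  have dist: "distinct L" "distinct R" "set L \<inter> set R = {}" "Suc n \<notin> set L \<union> set R"
    using \<pi>(2) LR by auto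
  have "set L \<union> set R = set \<pi> - {Suc n}"
    using LR dist by auto
  moreover have "{1..Suc n} - {Suc n} = {1..n}"
    by auto
  ultimately have un: "set L \<union> set R = {1..n}"
    by (simp only: \<pi>(1))
  have lt: "x < Suc n" if "x \<in> set L \<union> set R" for x
    using that unfolding un by auto
  show thesis
  proof (cases "R = []")
    case True
    have "subseq L \<pi>" unfolding LR by (intro subseq_rev_drop_many) simp
    then have "avoids L [1, 3, 2]" "avoids L [3, 2, 1]"
      using av contains_subseq[of L _ \<pi>] by blast+
    then have "L \<in> Av_132_321 n"
      using un dist True by (simp add: Av_132_321_def permutations_of_set_def)
    with True LR show thesis by (auto intro: snoc)
  next
    case False
    have sR: "sorted R"
    proof (rule ccontr)
      assume "\<not> sorted R"
      then obtain a b where "subseq [a, b] R" "b < a" by (rule subseq_pair_if_not_sorted)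
      moreover from this have "a \<in> set R" by (auto dest: subseq_imp_set_subset)
      \<comment> \<open>The maximum followed by an inversion of \<open>R\<close> is a 321.\<close>
      moreover have "subseq [Suc n, a, b] \<pi>"
        using \<open>subseq [a, b] R\<close> unfolding LR by (intro list_emb_append2) simp
      moreover have "a < Suc n" using \<open>a \<in> set R\<close> lt by blast
      ultimately show False using no321 by blast
    qed
    have RL: "c < a" if "a \<in> set L" "c \<in> set R" for a c
    proof -
      \<comment> \<open>This would be a 132 if a < c.\<close>
      have "subseq [a, Suc n, c] \<pi>"
        using that by (simp add: LR subseq_triple_append_iff subseq_singleton_left)
      moreover have "c < Suc n" "a \<noteq> c" using that lt dist by blast+
      ultimately show ?thesis using no132[of a "Suc n" c] by force
    qed
    have sL: "sorted L"
    proof (rule ccontr)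
      assume "\<not> sorted L"
      then obtain a b where ab: "subseq [a, b] L" "b < a" by (rule subseq_pair_if_not_sorted)
      \<comment> \<open>Nonemptiness of \<open>R\<close> provides the smallest entry of a 321 that
        starts with an inversion of \<open>L\<close>.\<close>
      obtain c where c: "c \<in> set R" using False by fastforce
      have "subseq [a, b, c] \<pi>"
        using ab c by (simp add: LR subseq_triple_append_iff)
      moreover have "c < b" using ab c by (auto intro!: RL dest: subseq_imp_set_subset)
      ultimately show False using no321[of a b c] ab(2) by simp
    qed
    have R_less: "\<forall>x\<in>set R. \<forall>y\<in>set L. x \<le> y"
      using RL by (auto simp: less_imp_le)
    have le: "\<forall>x\<in>set R \<union> set L. x \<le> Suc n"
      using lt by (auto simp: less_imp_le)
    \<comment> \<open>Exchanging the two blocks sorts the permutation; cutting the sorted list after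
      \<open>length R\<close> entries then recovers both blocks.\<close>
    have "R @ L @ [Suc n] = [1..<Suc (Suc n)]"
    proof (rule sorted_distinct_set_unique)
      show "sorted (R @ L @ [Suc n])"
        using sR sL R_less le by (auto simp: sorted_append)
      show "distinct (R @ L @ [Suc n])"
        using dist by auto
      show "set (R @ L @ [Suc n]) = set [1..<Suc (Suc n)]"
      proof -
        have "set (R @ L @ [Suc n]) = insert (Suc n) (set L \<union> set R)" by auto
        also have "\<dots> = set [1..<Suc (Suc n)]" unfolding un by auto
        finally show ?thesis .
      qed
    qed (auto simp del: upt_Suc)
    then have "R = take (length R) [1..<Suc (Suc n)]"
      and "L @ [Suc n] = drop (length R) [1..<Suc (Suc n)]"
      by (metis append_eq_conv_conj)+
    moreover have "length R \<le> n"
    proof -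
      have "card (set R) \<le> card {1..n}"
        using un by (intro card_mono) auto
      then show ?thesis using dist by (simp add: distinct_card)
    qed
    ultimately have "R = [1..<Suc (length R)]" and "L @ [Suc n] = [Suc (length R)..<Suc (Suc n)]"
      by (simp_all add: take_upt drop_upt del: upt_Suc)
    then have "\<pi> = rot_id (Suc n) (length R)"
      by (metis LR append.assoc append_Cons append_Nil rot_id_def)
    moreover have "length R \<in> {1..n}"
      using \<open>length R \<le> n\<close> False by (simp add: Suc_le_eq)
    ultimately show thesis by (intro rot)
  qed
qed

lemma Av_Suc: "Av_132_321 (Suc n) = (\<lambda>\<sigma>. \<sigma> @ [Suc n]) ` Av_132_321 n \<union> rot_id (Suc n) ` {1..n}"
  by (auto intro: snoc_max_in_Av rot_id_in_Av elim: Av_SucE)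

section \<open>Peaks and the count\<close>

text \<open>Any new window of three ends in \<open>m\<close>, which exceeds the entry before it, so
  that window is not a peak.\<close>

lemma pk_snoc_max:
  assumes "\<forall>x\<in>set xs. x < m"
  shows "pk (xs @ [m]) = pk xs"
proof -
  have "{i. i + 2 < length (xs @ [m]) \<and> (xs @ [m]) ! i < (xs @ [m]) ! (i + 1) \<and>
        (xs @ [m]) ! (i + 1) > (xs @ [m]) ! (i + 2)} =
      {i. i + 2 < length xs \<and> xs ! i < xs ! (i + 1) \<and> xs ! (i + 1) > xs ! (i + 2)}"
    (is "?S = ?T")
  proof
    show "?S \<subseteq> ?T"
    proof
      fix i assume i: "i \<in> ?S"
      have "i + 2 < length xs"
      proof (rule ccontr)
        assume "\<not> i + 2 < length xs"
        with i have "i + 2 = length xs" by simp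
        then have "(xs @ [m]) ! (i + 2) = m" "(xs @ [m]) ! (i + 1) \<in> set xs"
          by (auto simp: nth_append)
        with i assms show False by auto
      qed
      with i show "i \<in> ?T" by (simp add: nth_append)
    qed
  qed (auto simp: nth_append)
  then show ?thesis by (simp only: pk_def)
qed

text \<open>The only descent is from n + 1 to 1 at the junction. It makes a peak exactly when the
  first block, of length n + 1 - r, has at least two entries.\<close>

lemma pk_rot_id:
  assumes "r \<in> {1..n}"
  shows "pk (rot_id (Suc n) r) = (if r < n then 1 else 0)"
proof -
  have nth: "rot_id (Suc n) r ! i = (if i < Suc n - r then Suc r + i else Suc (i - (Suc n - r)))"
    if "i < Suc n" for i
    using assms that by (auto simp: rot_id_def nth_append simp del: upt_Suc)
  have len: "length (rot_id (Suc n) r) = Suc n"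
    using assms by (simp add: rot_id_def)
  have "{i. i + 2 < length (rot_id (Suc n) r) \<and>
        rot_id (Suc n) r ! i < rot_id (Suc n) r ! (i + 1) \<and>
        rot_id (Suc n) r ! (i + 1) > rot_id (Suc n) r ! (i + 2)} =
      (if r < n then {n - r - 1} else {})"
    using assms by (auto simp: len nth split: if_splits)
  then show ?thesis by (simp add: pk_def)
qed

lemma inj_on_rot_id: "inj_on (rot_id (Suc n)) {1..n}"
proof (rule inj_onI)
  fix r s assume rs: "r \<in> {1..n}" "s \<in> {1..n}" "rot_id (Suc n) r = rot_id (Suc n) s"
  \<comment> \<open>The first block is nonempty because q \<le> n, so the first entry determines the
    rotation.\<close>
  have "hd (rot_id (Suc n) q) = Suc q" if "q \<in> {1..n}" for q
    using that by (simp add: rot_id_def upt_rec)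
  with rs show "r = s" by (metis Suc_inject)
qed

lemma card_Av_pk_Suc:
  "card {\<pi> \<in> Av_132_321 (Suc n). pk \<pi> = k} =
     card {\<pi> \<in> Av_132_321 n. pk \<pi> = k} + card {r \<in> {1..n}. (if r < n then 1 else 0) = k}"
proof -
  let ?A = "{\<pi> \<in> Av_132_321 n. pk \<pi> = k}" and ?B = "{r \<in> {1..n}. (if r < n then 1 else 0) = k}"
  have "pk (\<sigma> @ [Suc n]) = pk \<sigma>" if "\<sigma> \<in> Av_132_321 n" for \<sigma>
    using that by (intro pk_snoc_max) (auto simp: Av_132_321_def permutations_of_set_def)
  then have "{\<pi> \<in> Av_132_321 (Suc n). pk \<pi> = k} = (\<lambda>\<sigma>. \<sigma> @ [Suc n]) ` ?A \<union> rot_id (Suc n) ` ?B"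
    unfolding Av_Suc using pk_rot_id[of _ n] by (auto simp del: atLeastAtMost_iff)
  moreover have "(\<lambda>\<sigma>. \<sigma> @ [Suc n]) ` ?A \<inter> rot_id (Suc n) ` ?B = {}"
  proof -
    \<comment> \<open>The last entry separates the two families: it is at most n for these rotations
      and n + 1 for the extensions.\<close>
    have "last (rot_id (Suc n) r) = r" if "r \<in> {1..n}" for r
      using that by (simp add: rot_id_def)
    then have "rot_id (Suc n) r \<noteq> \<sigma> @ [Suc n]" if "r \<in> {1..n}" for r \<sigma>
      using that by (metis Suc_n_not_le_n atLeastAtMost_iff last_snoc)
    then have "(\<lambda>\<sigma>. \<sigma> @ [Suc n]) ` X \<inter> rot_id (Suc n) ` {1..n} = {}" for X
      by (metis (no_types, lifting) disjoint_iff imageE)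
    then show ?thesis by blast
  qed
  ultimately have "card {\<pi> \<in> Av_132_321 (Suc n). pk \<pi> = k} =
      card ((\<lambda>\<sigma>. \<sigma> @ [Suc n]) ` ?A) + card (rot_id (Suc n) ` ?B)"
    by (simp add: card_Un_disjoint finite_Av)
  also have "card ((\<lambda>\<sigma>. \<sigma> @ [Suc n]) ` ?A) = card ?A"
    by (intro card_image) (simp add: inj_on_def)
  also have "card (rot_id (Suc n) ` ?B) = card ?B"
    by (intro card_image inj_on_subset[OF inj_on_rot_id]) auto
  finally show ?thesis .
qed

theorem proposition24:
  fixes n k :: nat
  assumes "n \<ge> 1"
  shows "a_pk n k {[1, 3, 2], [3, 2, 1]} =
           (if k = 0 then n else if k = 1 then (n - 1) choose 2 else 0)"
  using assms unfolding a_pk_eq_card_Av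
proof (induction n rule: nat_induct_at_least)
  case base
  \<comment> \<open>The recursion is started at size 0, where no rotations are added, to obtain the
    case of size 1.\<close>
  have "Av_132_321 0 = {[]}"
    unfolding Av_132_321_def by (simp add: contains_132_iff contains_321_iff del: One_nat_def) auto
  moreover have "pk [] = 0"
    by (simp add: pk_def)
  ultimately have "{\<pi> \<in> Av_132_321 0. pk \<pi> = k} = (if k = 0 then {[]} else {})"
    by (simp add: Collect_conv_if)
  then show ?case
    using card_Av_pk_Suc[of 0 k] by simp
next
  case (Suc n)
  \<comment> \<open>Each step adds one permutation without peaks, from r = n, and n - 1 permutations
    with one peak.\<close>
  have "{r \<in> {1..n}. (if r < n then 1 else 0) = k} =
      (if k = 0 then {n} else if k = 1 then {1..<n} else {})"
    using Suc.hyps by (auto split: if_splits)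
  \<comment> \<open>Pascal's rule, with the term n - 1 choose 1 evaluated.\<close>
  moreover have "n choose 2 = (n - 1 choose 2) + (n - 1)"
    using Suc.hyps by (cases n) (simp_all add: numeral_2_eq_2)
  ultimately show ?case
    using Suc.IH card_Av_pk_Suc[of n k] by simp
qed

end
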